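(* Let $A$ be a (complex) Banach algebra with $\Delta(A)\neq\emptyset$ and let $I$ be a closed two-sided ideal of $A$ which has a bounded $\Delta$-weak approximate identity, and suppose that the quotient Banach algebra $A/I$ has a bounded left approximate identity. Then $A$ has a bounded $\Delta$-weak approximate identity.
   Context: $\Delta(A)$ denotes the set of all nonzero algebra homomorphisms $A\to\mathbb{C}$ (characters; these are automatically bounded). For a subspace $B\subseteq A$ (in particular $B=I$ or $B=A$), a $\Delta$-weak approximate identity for $B$ is a net $\{a_\alpha\}$ in $B$ such that $\lim_\alpha|\psi(aa_\alpha)-\psi(a)|=0$ for all $a\in B$ and all $\psi\in\Delta(A)$; it is bounded if $\sup_\alpha\|a_\alpha\|<\infty$. A bounded left approximate identity for a Banach algebra $C$ is a norm-bounded net $\{f_\delta\}$ in $C$ with $\|f_\delta c-c\|\to0$ for every $c\in C$. *)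

theory Defs
  imports "HOL-Analysis.Analysis"
begin

text \<open>Complex Banach algebras, not assumed unital or commutative. Submultiplicativity of the norm
  comes from \<^class>\<open>real_normed_algebra\<close>, completeness from \<^class>\<open>banach\<close>.\<close>

class complex_banach_algebra = real_normed_algebra + banach +
  fixes scaleC :: "complex \<Rightarrow> 'a \<Rightarrow> 'a"
  assumes scaleC_add_right: "scaleC c (x + y) = scaleC c x + scaleC c y"
    and scaleC_add_left: "scaleC (c + d) x = scaleC c x + scaleC d x"
    and scaleC_scaleC: "scaleC c (scaleC d x) = scaleC (c * d) x"
    and scaleC_of_real: "scaleC (complex_of_real r) x = scaleR r x"
    and norm_scaleC: "norm (scaleC c x) = cmod c * norm x"
    and mult_scaleC_left: "scaleC c x * y = scaleC c (x * y)"
    and mult_scaleC_right: "x * scaleC c y = scaleC c (x * y)"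

definition characters :: "('a::complex_banach_algebra \<Rightarrow> complex) set" where
  "characters = {\<psi>. (\<forall>x y. \<psi> (x + y) = \<psi> x + \<psi> y) \<and> (\<forall>c x. \<psi> (scaleC c x) = c * \<psi> x) \<and>
     (\<forall>x y. \<psi> (x * y) = \<psi> x * \<psi> y) \<and> (\<exists>x. \<psi> x \<noteq> 0)}"

definition closed_two_sided_ideal :: "'a::complex_banach_algebra set \<Rightarrow> bool" where
  "closed_two_sided_ideal I \<longleftrightarrow> closed I \<and> 0 \<in> I \<and> (\<forall>x\<in>I. \<forall>y\<in>I. x + y \<in> I) \<and>
     (\<forall>c. \<forall>x\<in>I. scaleC c x \<in> I) \<and> (\<forall>a. \<forall>x\<in>I. a * x \<in> I \<and> x * a \<in> I)"

subsection \<open>Nets\<close>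

definition directed_set :: "'i set \<Rightarrow> ('i \<Rightarrow> 'i \<Rightarrow> bool) \<Rightarrow> bool" where
  "directed_set D le \<longleftrightarrow> D \<noteq> {} \<and> reflp_on D le \<and> transp_on D le \<and>
     (\<forall>d\<in>D. \<forall>e\<in>D. \<exists>f\<in>D. le d f \<and> le e f)"

text \<open>The filter of tails: \<open>(f \<longlongrightarrow> l) (tails D le)\<close> is convergence of the net \<open>f\<close> over the
  directed set \<open>D\<close>.\<close>

definition tails :: "'i set \<Rightarrow> ('i \<Rightarrow> 'i \<Rightarrow> bool) \<Rightarrow> 'i filter" where
  "tails D le = (INF d\<in>D. principal {e\<in>D. le d e})"

lemma eventually_tails:
  assumes "directed_set D le"
  shows "eventually P (tails D le) \<longleftrightarrow> (\<exists>d\<in>D. \<forall>e\<in>D. le d e \<longrightarrow> P e)"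
proof -
  have "eventually P (tails D le) \<longleftrightarrow> (\<exists>d\<in>D. eventually P (principal {e\<in>D. le d e}))"
    unfolding tails_def
  proof (rule eventually_INF_base)
    show "D \<noteq> {}" using assms by (simp add: directed_set_def)
    fix a b assume ab: "a \<in> D" "b \<in> D"
    then obtain f where f: "f \<in> D" "le a f" "le b f"
      using assms by (auto simp: directed_set_def)
    have tr: "transp_on D le" using assms by (simp add: directed_set_def)
    have "{e\<in>D. le f e} \<subseteq> {e\<in>D. le a e} \<inter> {e\<in>D. le b e}"
      using ab f transp_onD[OF tr] by blast
    then show "\<exists>x\<in>D. principal {e\<in>D. le x e} \<le> inf (principal {e\<in>D. le a e}) (principal {e\<in>D. le b e})"
      using f(1) by auto
  qed
  then show ?thesis by (auto simp: eventually_principal)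
qed

text \<open>Existence of a net cannot quantify over index types inside a formula. Every net in a type
  \<open>'b\<close> can, however, be replaced by one indexed by a directed subset of \<open>'b set\<close> (its tails, under
  reverse inclusion), with values among the old ones and at least the same limits. The existential
  definitions below therefore use the index type \<open>'b set\<close>; the lemmas \<open>has_bdd_weak_aiI\<close> and
  \<open>has_bdd_left_aiI\<close> show that this is no restriction.\<close>

lemma net_reindex:
  fixes f :: "'i \<Rightarrow> 'b"
  assumes dir: "directed_set D le"
  obtains D' :: "'b set set" and le' :: "'b set \<Rightarrow> 'b set \<Rightarrow> bool" and g :: "'b set \<Rightarrow> 'b" where
    "directed_set D' le'" "g ` D' \<subseteq> f ` D" "filtermap g (tails D' le') \<le> filtermap f (tails D le)"
proof -
  define T where "T d = f ` {e\<in>D. le d e}" for d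
  define D' where "D' = T ` D"
  define le' :: "'b set \<Rightarrow> 'b set \<Rightarrow> bool" where "le' S S' \<longleftrightarrow> S' \<subseteq> S" for S S'
  define g where "g S = (SOME x. x \<in> S)" for S :: "'b set"
  have refl: "le d d" if "d \<in> D" for d
    using dir that by (auto simp: directed_set_def dest: reflp_onD)
  have tr: "transp_on D le" using dir by (simp add: directed_set_def)
  have gT: "g (T d) \<in> T d" if "d \<in> D" for d
    unfolding g_def by (rule someI[of _ "f d"]) (use that refl in \<open>auto simp: T_def\<close>)
  have mono: "T e \<subseteq> T d" if "d \<in> D" "e \<in> D" "le d e" for d e
    using that transp_onD[OF tr] unfolding T_def by blast
  have dir': "directed_set D' le'"
    unfolding directed_set_def
  proof (intro conjI)
    show "D' \<noteq> {}" using dir by (simp add: D'_def directed_set_def)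
    show "reflp_on D' le'" by (simp add: reflp_on_def le'_def)
    show "transp_on D' le'" by (auto simp: transp_on_def le'_def)
    show "\<forall>d\<in>D'. \<forall>e\<in>D'. \<exists>f\<in>D'. le' d f \<and> le' e f"
    proof (intro ballI)
      fix S S' assume "S \<in> D'" "S' \<in> D'"
      then obtain d e where de: "d \<in> D" "e \<in> D" "S = T d" "S' = T e" by (auto simp: D'_def)
      then obtain u where "u \<in> D" "le d u" "le e u" using dir by (auto simp: directed_set_def)
      then show "\<exists>f\<in>D'. le' S f \<and> le' S' f"
        using de mono by (intro bexI[of _ "T u"]) (auto simp: le'_def D'_def)
    qed
  qed
  have "g ` D' \<subseteq> f ` D"
  proof
    fix x assume "x \<in> g ` D'"
    then obtain d where "d \<in> D" "x = g (T d)" by (auto simp: D'_def)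
    then have "x \<in> T d" using gT by simp
    then show "x \<in> f ` D" by (auto simp: T_def)
  qed
  moreover have "filtermap g (tails D' le') \<le> filtermap f (tails D le)"
  proof (rule filter_leI)
    fix P assume "eventually P (filtermap f (tails D le))"
    then obtain d where d: "d \<in> D" "\<forall>e\<in>D. le d e \<longrightarrow> P (f e)"
      by (auto simp: eventually_filtermap eventually_tails[OF dir])
    then have PT: "P x" if "x \<in> T d" for x using that by (auto simp: T_def)
    have "P (g S)" if "S \<in> D'" "le' (T d) S" for S
      using that gT PT unfolding D'_def le'_def by blast
    then show "eventually P (filtermap g (tails D' le'))"
      unfolding eventually_filtermap eventually_tails[OF dir'] using d(1) D'_def by blast
  qed
  ultimately show thesis using that dir' by blast
qed

lemma tendsto_reindex:
  assumes "filtermap g F' \<le> filtermap f F" "((\<lambda>i. h (f i)) \<longlongrightarrow> l) F"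
  shows "((\<lambda>i. h (g i)) \<longlongrightarrow> l) F'"
proof -
  have "(h \<longlongrightarrow> l) (filtermap f F)" using assms(2) by (simp add: filterlim_filtermap)
  then have "(h \<longlongrightarrow> l) (filtermap g F')" using assms(1) tendsto_mono by blast
  then show ?thesis by (simp add: filterlim_filtermap)
qed

subsection \<open>Bounded weak approximate identities with respect to the characters\<close>

definition bdd_weak_ai ::
  "'a::complex_banach_algebra set \<Rightarrow> 'i set \<Rightarrow> ('i \<Rightarrow> 'i \<Rightarrow> bool) \<Rightarrow> ('i \<Rightarrow> 'a) \<Rightarrow> bool" where
  "bdd_weak_ai B D le e \<longleftrightarrow> directed_set D le \<and> e ` D \<subseteq> B \<and> bdd_above ((\<lambda>\<alpha>. norm (e \<alpha>)) ` D) \<and>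
     (\<forall>a\<in>B. \<forall>\<psi>\<in>characters. ((\<lambda>\<alpha>. cmod (\<psi> (a * e \<alpha>) - \<psi> a)) \<longlongrightarrow> 0) (tails D le))"

definition has_bdd_weak_ai :: "'a::complex_banach_algebra set \<Rightarrow> bool" where
  "has_bdd_weak_ai B \<longleftrightarrow> (\<exists>(D :: 'a set set) le e. bdd_weak_ai B D le e)"

lemma has_bdd_weak_aiI:
  fixes B :: "'a::complex_banach_algebra set"
  assumes ai: "bdd_weak_ai B D le e"
  shows "has_bdd_weak_ai B"
proof -
  have "directed_set D le" using ai by (simp add: bdd_weak_ai_def)
  then obtain D' :: "'a set set" and le' g where g: "directed_set D' le'" "g ` D' \<subseteq> e ` D"
    "filtermap g (tails D' le') \<le> filtermap e (tails D le)"
    by (rule net_reindex[where f = e])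
  have bdd: "bdd_above (norm ` e ` D)" using ai by (simp add: bdd_weak_ai_def image_image)
  have "bdd_weak_ai B D' le' g"
    unfolding bdd_weak_ai_def
  proof (intro conjI ballI)
    show "directed_set D' le'" by fact
    show "g ` D' \<subseteq> B" using g(2) ai by (auto simp: bdd_weak_ai_def)
    have "bdd_above (norm ` g ` D')" using bdd g(2) bdd_above_mono image_mono by metis
    then show "bdd_above ((\<lambda>\<alpha>. norm (g \<alpha>)) ` D')" by (simp add: image_image)
    fix a and \<psi> :: "'a \<Rightarrow> complex" assume "a \<in> B" "\<psi> \<in> characters"
    then have "((\<lambda>\<alpha>. cmod (\<psi> (a * e \<alpha>) - \<psi> a)) \<longlongrightarrow> 0) (tails D le)"
      using ai by (simp add: bdd_weak_ai_def)
    then show "((\<lambda>\<alpha>. cmod (\<psi> (a * g \<alpha>) - \<psi> a)) \<longlongrightarrow> 0) (tails D' le')"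
      by (rule tendsto_reindex[OF g(3), where h = "\<lambda>x. cmod (\<psi> (a * x) - \<psi> a)"])
  qed
  then show ?thesis unfolding has_bdd_weak_ai_def by blast
qed

subsection \<open>Bounded left approximate identities\<close>

text \<open>A quotient algebra is not a type here, so the algebra is given by its carrier \<open>C\<close> together
  with its difference, product and norm.\<close>

definition bdd_left_ai ::
  "'b set \<Rightarrow> ('b \<Rightarrow> 'b \<Rightarrow> 'b) \<Rightarrow> ('b \<Rightarrow> 'b \<Rightarrow> 'b) \<Rightarrow> ('b \<Rightarrow> real) \<Rightarrow>
    'i set \<Rightarrow> ('i \<Rightarrow> 'i \<Rightarrow> bool) \<Rightarrow> ('i \<Rightarrow> 'b) \<Rightarrow> bool" where
  "bdd_left_ai C diff mul nrm D le f \<longleftrightarrow>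
     directed_set D le \<and> f ` D \<subseteq> C \<and> bdd_above ((\<lambda>\<delta>. nrm (f \<delta>)) ` D) \<and>
     (\<forall>c\<in>C. ((\<lambda>\<delta>. nrm (diff (mul (f \<delta>) c) c)) \<longlongrightarrow> 0) (tails D le))"

definition has_bdd_left_ai ::
  "'b set \<Rightarrow> ('b \<Rightarrow> 'b \<Rightarrow> 'b) \<Rightarrow> ('b \<Rightarrow> 'b \<Rightarrow> 'b) \<Rightarrow> ('b \<Rightarrow> real) \<Rightarrow> bool" where
  "has_bdd_left_ai C diff mul nrm \<longleftrightarrow>
     (\<exists>(D :: 'b set set) le f. bdd_left_ai C diff mul nrm D le f)"

lemma has_bdd_left_aiI:
  fixes C :: "'b set"
  assumes ai: "bdd_left_ai C diff mul nrm D le f"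
  shows "has_bdd_left_ai C diff mul nrm"
proof -
  have "directed_set D le" using ai by (simp add: bdd_left_ai_def)
  then obtain D' :: "'b set set" and le' g where g: "directed_set D' le'" "g ` D' \<subseteq> f ` D"
    "filtermap g (tails D' le') \<le> filtermap f (tails D le)"
    by (rule net_reindex[where f = f])
  have bdd: "bdd_above (nrm ` f ` D)" using ai by (simp add: bdd_left_ai_def image_image)
  have "bdd_left_ai C diff mul nrm D' le' g"
    unfolding bdd_left_ai_def
  proof (intro conjI ballI)
    show "directed_set D' le'" by fact
    show "g ` D' \<subseteq> C" using g(2) ai by (auto simp: bdd_left_ai_def)
    have "bdd_above (nrm ` g ` D')" using bdd g(2) bdd_above_mono image_mono by metis
    then show "bdd_above ((\<lambda>\<alpha>. nrm (g \<alpha>)) ` D')" by (simp add: image_image)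
    fix c assume "c \<in> C"
    then have "((\<lambda>\<delta>. nrm (diff (mul (f \<delta>) c) c)) \<longlongrightarrow> 0) (tails D le)"
      using ai by (simp add: bdd_left_ai_def)
    then show "((\<lambda>\<delta>. nrm (diff (mul (g \<delta>) c) c)) \<longlongrightarrow> 0) (tails D' le')"
      by (rule tendsto_reindex[OF g(3), where h = "\<lambda>x. nrm (diff (mul x c) c)"])
  qed
  then show ?thesis unfolding has_bdd_left_ai_def by blast
qed

subsection \<open>The quotient algebra\<close>

definition ideal_coset :: "'a::complex_banach_algebra set \<Rightarrow> 'a \<Rightarrow> 'a set" where
  "ideal_coset I a = (\<lambda>x. a + x) ` I"

definition quot_carrier :: "'a::complex_banach_algebra set \<Rightarrow> 'a set set" where
  "quot_carrier I = range (ideal_coset I)"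

definition quot_diff :: "'a::complex_banach_algebra set \<Rightarrow> 'a set \<Rightarrow> 'a set \<Rightarrow> 'a set" where
  "quot_diff I X Y = (\<Union>x\<in>X. \<Union>y\<in>Y. ideal_coset I (x - y))"

definition quot_mult :: "'a::complex_banach_algebra set \<Rightarrow> 'a set \<Rightarrow> 'a set \<Rightarrow> 'a set" where
  "quot_mult I X Y = (\<Union>x\<in>X. \<Union>y\<in>Y. ideal_coset I (x * y))"

definition quot_norm :: "'a::complex_banach_algebra set \<Rightarrow> real" where
  "quot_norm X = (INF x\<in>X. norm x)"

lemma ideal_coset_eq:
  assumes I: "closed_two_sided_ideal I" and "a - b \<in> I"
  shows "ideal_coset I a = ideal_coset I b"
proof -
  have neg: "- x \<in> I" if "x \<in> I" for x
  proof -
    have "scaleC (complex_of_real (-1)) x \<in> I"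
      using I that by (auto simp: closed_two_sided_ideal_def)
    then show ?thesis by (simp only: scaleC_of_real) simp
  qed
  have sub: "ideal_coset I u \<subseteq> ideal_coset I v" if "u - v \<in> I" for u v
  proof
    fix z assume "z \<in> ideal_coset I u"
    then obtain x where x: "x \<in> I" "z = u + x" by (auto simp: ideal_coset_def)
    then have "(u - v) + x \<in> I" "z = v + ((u - v) + x)"
      using I that by (auto simp: closed_two_sided_ideal_def)
    then show "z \<in> ideal_coset I v" unfolding ideal_coset_def by blast
  qed
  have "b - a \<in> I" using neg[OF assms(2)] by simp
  with sub[of a b] sub[of b a] assms(2) show ?thesis by blast
qed

lemma quot_diff_coset:
  assumes I: "closed_two_sided_ideal I"
  shows "quot_diff I (ideal_coset I a) (ideal_coset I b) = ideal_coset I (a - b)"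
proof -
  have "ideal_coset I ((a + x) - (b + y)) = ideal_coset I (a - b)" if xy: "x \<in> I" "y \<in> I" for x y
  proof (rule ideal_coset_eq[OF I])
    have "scaleC (complex_of_real (-1)) y \<in> I"
      using I xy by (auto simp: closed_two_sided_ideal_def)
    then have "- y \<in> I" by (simp only: scaleC_of_real) simp
    then have "x + - y \<in> I" using I xy(1) unfolding closed_two_sided_ideal_def by blast
    then show "(a + x) - (b + y) - (a - b) \<in> I" by (simp add: algebra_simps)
  qed
  moreover have "I \<noteq> {}" using I by (auto simp: closed_two_sided_ideal_def)
  ultimately show ?thesis
    by (auto simp: quot_diff_def ideal_coset_def[of I a] ideal_coset_def[of I b])
qed

lemma quot_mult_coset:
  assumes I: "closed_two_sided_ideal I"
  shows "quot_mult I (ideal_coset I a) (ideal_coset I b) = ideal_coset I (a * b)"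
proof -
  have "ideal_coset I ((a + x) * (b + y)) = ideal_coset I (a * b)" if xy: "x \<in> I" "y \<in> I" for x y
  proof (rule ideal_coset_eq[OF I])
    have "a * y + (x * b + x * y) \<in> I"
      using I xy by (simp add: closed_two_sided_ideal_def)
    then show "(a + x) * (b + y) - a * b \<in> I" by (simp add: algebra_simps)
  qed
  moreover have "I \<noteq> {}" using I by (auto simp: closed_two_sided_ideal_def)
  ultimately show ?thesis
    by (auto simp: quot_mult_def ideal_coset_def[of I a] ideal_coset_def[of I b])
qed

definition quotient_has_bdd_left_ai :: "'a::complex_banach_algebra set \<Rightarrow> bool" where
  "quotient_has_bdd_left_ai I \<longleftrightarrow>
     has_bdd_left_ai (quot_carrier I) (quot_diff I) (quot_mult I) quot_norm"

end

theory Submission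
  imports Defs
begin

text \<open>Let \<open>e\<^sub>\<alpha>\<close> be the given net in \<open>I\<close> and lift the bounded left approximate identity of the
  quotient to a bounded net \<open>f\<^sub>\<delta>\<close> in the algebra. The net \<open>e\<^sub>\<alpha> + f\<^sub>\<delta> - e\<^sub>\<alpha> f\<^sub>\<delta>\<close> over the product
  order works: \<open>1 - \<psi> (e\<^sub>\<alpha> + f\<^sub>\<delta> - e\<^sub>\<alpha> f\<^sub>\<delta>) = (1 - \<psi> e\<^sub>\<alpha>) (1 - \<psi> f\<^sub>\<delta>)\<close>, where the first factor tends
  to \<open>0\<close> if \<open>\<psi>\<close> does not vanish on \<open>I\<close>, and the second one does if \<open>\<psi>\<close> factors through the
  quotient. Characters are contractive, so the other factor stays bounded.\<close>

definition prod_le :: "('i \<Rightarrow> 'i \<Rightarrow> bool) \<Rightarrow> ('j \<Rightarrow> 'j \<Rightarrow> bool) \<Rightarrow> 'i \<times> 'j \<Rightarrow> 'i \<times> 'j \<Rightarrow> bool" where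
  "prod_le le le' p q \<longleftrightarrow> le (fst p) (fst q) \<and> le' (snd p) (snd q)"

lemma directed_set_prod:
  assumes D: "directed_set D le" and E: "directed_set E le'"
  shows "directed_set (D \<times> E) (prod_le le le')"
  unfolding directed_set_def
proof (intro conjI ballI)
  show "D \<times> E \<noteq> {}" using D E by (auto simp: directed_set_def)
  show "reflp_on (D \<times> E) (prod_le le le')"
    using D E by (auto simp: directed_set_def reflp_on_def prod_le_def)
  have "transp_on D le" "transp_on E le'" using D E by (auto simp: directed_set_def)
  then show "transp_on (D \<times> E) (prod_le le le')"
    unfolding transp_on_def prod_le_def by (metis mem_Times_iff)
  fix p q assume "p \<in> D \<times> E" "q \<in> D \<times> E"
  then have "\<exists>u\<in>D. le (fst p) u \<and> le (fst q) u" "\<exists>v\<in>E. le' (snd p) v \<and> le' (snd q) v"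
    using D E by (auto simp: directed_set_def)
  then show "\<exists>r\<in>D \<times> E. prod_le le le' p r \<and> prod_le le le' q r"
    by (auto simp: prod_le_def)
qed

text \<open>The preimage under \<open>fst\<close> of the tail beyond \<open>d\<close> contains the
  tail beyond \<open>(d, v)\<close> for any \<open>v\<close> in \<open>E\<close>, and a directed set
  is nonempty. This and the mirror lemma for \<open>snd\<close> carry limits along either net over
  to the product net.\<close>

lemma filterlim_fst_tails:
  assumes "directed_set D le" "directed_set E le'"
  shows "filterlim fst (tails D le) (tails (D \<times> E) (prod_le le le'))"
  unfolding filterlim_iff eventually_tails[OF assms(1)]
    eventually_tails[OF directed_set_prod[OF assms]]
  using assms(2) by (fastforce simp: directed_set_def prod_le_def)

lemma filterlim_snd_tails:
  assumes "directed_set D le" "directed_set E le'"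
  shows "filterlim snd (tails E le') (tails (D \<times> E) (prod_le le le'))"
  unfolding filterlim_iff eventually_tails[OF assms(2)]
    eventually_tails[OF directed_set_prod[OF assms]]
  using assms(1) by (fastforce simp: directed_set_def prod_le_def)

lemma eventually_tails_mem:
  assumes "directed_set D le"
  shows "eventually (\<lambda>d. d \<in> D) (tails D le)"
  using assms unfolding eventually_tails[OF assms] by (auto simp: directed_set_def)

lemma charactersD:
  assumes "\<psi> \<in> characters"
  shows "\<psi> (x + y) = \<psi> x + \<psi> y" "\<psi> (x - y) = \<psi> x - \<psi> y" "\<psi> (x * y) = \<psi> x * \<psi> y"
    "\<psi> (scaleC c x) = c * \<psi> x"
proof -
  have add: "\<psi> (x + y) = \<psi> x + \<psi> y" for x y using assms by (simp add: characters_def)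
  show "\<psi> (x + y) = \<psi> x + \<psi> y" by (rule add)
  show "\<psi> (x - y) = \<psi> x - \<psi> y" using add[of "x - y" y] by (simp add: algebra_simps)
  show "\<psi> (x * y) = \<psi> x * \<psi> y" "\<psi> (scaleC c x) = c * \<psi> x"
    using assms by (auto simp: characters_def)
qed

text \<open>If \<open>\<psi> u = 1\<close> and \<open>\<parallel>u\<parallel> < 1\<close>, the contraction \<open>y \<mapsto> u + u y\<close> has a fixed point, at which
  \<open>\<psi> y = 1 + \<psi> y\<close>. No unit is needed.\<close>

lemma norm_character_le:
  fixes \<psi> :: "'a::complex_banach_algebra \<Rightarrow> complex"
  assumes "\<psi> \<in> characters"
  shows "cmod (\<psi> x) \<le> norm x"
proof (rule ccontr)
  note \<psi> = charactersD[OF assms]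
  assume "\<not> cmod (\<psi> x) \<le> norm x"
  then have lt: "norm x < cmod (\<psi> x)" by simp
  then have nz: "cmod (\<psi> x) > 0" using norm_ge_zero[of x] by linarith
  define u where "u = scaleC (inverse (\<psi> x)) x"
  have u1: "\<psi> u = 1" using nz by (simp add: u_def \<psi>)
  have nu: "norm u < 1" using lt nz by (simp add: u_def norm_scaleC norm_inverse flip: divide_inverse_commute)
  have "\<exists>!y\<in>UNIV. u + u * y = y"
  proof (rule Banach_fix[where c = "norm u"])
    fix y z
    have "dist (u + u * y) (u + u * z) = norm (u * (y - z))"
      by (simp add: dist_norm algebra_simps)
    also have "\<dots> \<le> norm u * dist y z" by (simp add: dist_norm norm_mult_ineq)
    finally show "dist (u + u * y) (u + u * z) \<le> norm u * dist y z" .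
  qed (use nu in \<open>auto simp: complete_UNIV\<close>)
  then obtain y where "u + u * y = y" by blast
  then have "\<psi> y = 1 + \<psi> y" using u1 \<psi>(1,3) by (metis mult_1)
  then show False by simp
qed

text \<open>The character is constant on the coset, so contractivity at every representative passes
  to the infimum. This turns limits in the quotient norm into limits of scalars without constructing
  the induced character on the quotient.\<close>

lemma norm_character_le_quot_norm:
  fixes \<psi> :: "'a::complex_banach_algebra \<Rightarrow> complex"
  assumes \<psi>: "\<psi> \<in> characters" and van: "\<forall>x\<in>I. \<psi> x = 0" and ne: "I \<noteq> {}"
  shows "cmod (\<psi> a) \<le> quot_norm (ideal_coset I a)"
  unfolding quot_norm_def
proof (rule cINF_greatest)
  show "ideal_coset I a \<noteq> {}" using ne by (simp add: ideal_coset_def)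
  fix y assume "y \<in> ideal_coset I a"
  then have "\<psi> y = \<psi> a" using van charactersD(1)[OF \<psi>] by (auto simp: ideal_coset_def)
  then show "cmod (\<psi> a) \<le> norm y" using norm_character_le[OF \<psi>, of y] by simp
qed

text \<open>Multiplicativity lets the defining limit at \<open>a\<close> be divided by
  \<open>\<psi> a\<close>. At a character that vanishes on \<open>B\<close> the defining limit
  carries no information, hence the witness \<open>a\<close>.\<close>

lemma bdd_weak_ai_tendsto_one:
  fixes \<psi> :: "'a::complex_banach_algebra \<Rightarrow> complex"
  assumes ai: "bdd_weak_ai B D le e" and \<psi>: "\<psi> \<in> characters" and a: "a \<in> B" "\<psi> a \<noteq> 0"
  shows "((\<lambda>\<alpha>. \<psi> (e \<alpha>)) \<longlongrightarrow> 1) (tails D le)"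
proof -
  have "((\<lambda>\<alpha>. cmod (\<psi> (a * e \<alpha>) - \<psi> a)) \<longlongrightarrow> 0) (tails D le)"
    using ai \<psi> a by (simp add: bdd_weak_ai_def)
  then have "((\<lambda>\<alpha>. \<psi> a * \<psi> (e \<alpha>)) \<longlongrightarrow> \<psi> a) (tails D le)"
    unfolding charactersD(3)[OF \<psi>] by (rule LIM_zero_cancel[OF tendsto_norm_zero_cancel])
  then have "((\<lambda>\<alpha>. \<psi> a * \<psi> (e \<alpha>) / \<psi> a) \<longlongrightarrow> \<psi> a / \<psi> a) (tails D le)"
    using a by (intro tendsto_divide) auto
  then show ?thesis using a by simp
qed

text \<open>Since \<open>\<psi> (a * u \<alpha>) - \<psi> a = \<psi> a * (\<psi> (u \<alpha>) -
  1)\<close>, one scalar limit per character settles all \<open>a\<close> at once.\<close>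

lemma bdd_weak_ai_UNIV_I:
  fixes u :: "'i \<Rightarrow> 'a::complex_banach_algebra"
  assumes "directed_set D le" "bdd_above ((\<lambda>\<alpha>. norm (u \<alpha>)) ` D)"
    and lim: "\<And>\<psi>. \<psi> \<in> characters \<Longrightarrow> ((\<lambda>\<alpha>. \<psi> (u \<alpha>)) \<longlongrightarrow> 1) (tails D le)"
  shows "bdd_weak_ai UNIV D le u"
  unfolding bdd_weak_ai_def
proof (intro conjI ballI)
  fix a and \<psi> :: "'a \<Rightarrow> complex" assume \<psi>: "\<psi> \<in> characters"
  have "((\<lambda>\<alpha>. \<psi> a * \<psi> (u \<alpha>) - \<psi> a) \<longlongrightarrow> \<psi> a * 1 - \<psi> a) (tails D le)"
    by (intro tendsto_intros lim \<psi>)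
  then show "((\<lambda>\<alpha>. cmod (\<psi> (a * u \<alpha>) - \<psi> a)) \<longlongrightarrow> 0) (tails D le)"
    by (simp add: charactersD[OF \<psi>] tendsto_norm_zero)
qed (use assms in auto)

text \<open>Bounded representatives of the cosets \<open>F \<delta>\<close> are chosen; the limit
  survives for exactly those characters that the cosets can see, namely those vanishing on
  \<open>I\<close>.\<close>

lemma quot_left_ai_lift:
  fixes I :: "'a::complex_banach_algebra set"
  assumes I: "closed_two_sided_ideal I"
    and ai: "bdd_left_ai (quot_carrier I) (quot_diff I) (quot_mult I) quot_norm D le F"
  obtains f :: "'i \<Rightarrow> 'a" where "bdd_above ((\<lambda>\<delta>. norm (f \<delta>)) ` D)"
    "\<And>\<psi>. \<psi> \<in> characters \<Longrightarrow> \<forall>x\<in>I. \<psi> x = 0 \<Longrightarrow> ((\<lambda>\<delta>. \<psi> (f \<delta>)) \<longlongrightarrow> 1) (tails D le)"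
proof -
  have I0: "0 \<in> I" using I by (simp add: closed_two_sided_ideal_def)
  have dir: "directed_set D le" using ai by (simp add: bdd_left_ai_def)
  obtain M where M: "\<And>\<delta>. \<delta> \<in> D \<Longrightarrow> quot_norm (F \<delta>) \<le> M"
    using ai by (auto simp: bdd_left_ai_def bdd_above_def)
  have "\<exists>x. F \<delta> = ideal_coset I x \<and> norm x \<le> M + 1" if \<delta>: "\<delta> \<in> D" for \<delta>
  proof -
    obtain b where b: "F \<delta> = ideal_coset I b"
      using ai \<delta> by (auto simp: bdd_left_ai_def quot_carrier_def)
    have "F \<delta> \<noteq> {}" using I0 by (auto simp: b ideal_coset_def)
    \<comment> \<open>The infimum need not be attained, so the bound is relaxed by 1 to get an
      actual representative.\<close>
    moreover have "Inf (norm ` F \<delta>) < M + 1" using M[OF \<delta>] by (simp add: quot_norm_def)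
    ultimately obtain x where x: "x \<in> F \<delta>" "norm x < M + 1"
      using cInf_lessD[of "norm ` F \<delta>"] by auto
    then have "x - b \<in> I" by (auto simp: b ideal_coset_def)
    then show ?thesis using ideal_coset_eq[OF I] b x by fastforce
  qed
  then obtain f where f: "\<And>\<delta>. \<delta> \<in> D \<Longrightarrow> F \<delta> = ideal_coset I (f \<delta>) \<and> norm (f \<delta>) \<le> M + 1"
    by metis
  show thesis
  proof (rule that)
    show "bdd_above ((\<lambda>\<delta>. norm (f \<delta>)) ` D)" using f by (intro bdd_aboveI2) blast
    fix \<psi> :: "'a \<Rightarrow> complex" assume \<psi>: "\<psi> \<in> characters" and van: "\<forall>x\<in>I. \<psi> x = 0"
    \<comment> \<open>The approximate identity is tested on the coset of this single element;
      dividing by \<open>\<psi> c\<close> at the end isolates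
      \<open>\<psi> (f \<delta>)\<close>.\<close>
    obtain c where c: "\<psi> c \<noteq> 0" using \<psi> by (auto simp: characters_def)
    let ?q = "\<lambda>\<delta>. quot_norm (quot_diff I (quot_mult I (F \<delta>) (ideal_coset I c)) (ideal_coset I c))"
    have "((\<lambda>\<delta>. \<psi> (f \<delta>) * \<psi> c - \<psi> c) \<longlongrightarrow> 0) (tails D le)"
    proof (rule Lim_null_comparison)
      show "(?q \<longlongrightarrow> 0) (tails D le)" using ai by (auto simp: bdd_left_ai_def quot_carrier_def)
      show "\<forall>\<^sub>F \<delta> in tails D le. cmod (\<psi> (f \<delta>) * \<psi> c - \<psi> c) \<le> ?q \<delta>"
        using eventually_tails_mem[OF dir]
      proof eventually_elim
        case (elim \<delta>)
        then show ?case
          using norm_character_le_quot_norm[OF \<psi> van, of "f \<delta> * c - c"] f[OF elim] I0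
          by (auto simp: quot_mult_coset[OF I] quot_diff_coset[OF I] charactersD[OF \<psi>])
      qed
    qed
    then have "((\<lambda>\<delta>. (\<psi> (f \<delta>) * \<psi> c - \<psi> c) / \<psi> c + 1) \<longlongrightarrow> 0 / \<psi> c + 1) (tails D le)"
      using c by (intro tendsto_intros)
    then show "((\<lambda>\<delta>. \<psi> (f \<delta>)) \<longlongrightarrow> 1) (tails D le)" using c by (simp add: diff_divide_distrib)
  qed
qed

theorem theorem2p7:
  fixes I :: "'a::complex_banach_algebra set"
  assumes "(characters :: ('a \<Rightarrow> complex) set) \<noteq> {}"
    and "closed_two_sided_ideal I"
    and "has_bdd_weak_ai I"
    and "quotient_has_bdd_left_ai I"
  shows "has_bdd_weak_ai (UNIV :: 'a set)"
proof -
  obtain D :: "'a set set" and le e where e: "bdd_weak_ai I D le e"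
    using assms(3) by (auto simp: has_bdd_weak_ai_def)
  obtain E :: "'a set set set" and le' F where
    F: "bdd_left_ai (quot_carrier I) (quot_diff I) (quot_mult I) quot_norm E le' F"
    using assms(4) by (auto simp: quotient_has_bdd_left_ai_def has_bdd_left_ai_def)
  obtain f where f_bdd: "bdd_above ((\<lambda>\<delta>. norm (f \<delta>)) ` E)"
    and f_lim: "\<And>\<psi>. \<psi> \<in> characters \<Longrightarrow> \<forall>x\<in>I. \<psi> x = 0 \<Longrightarrow> ((\<lambda>\<delta>. \<psi> (f \<delta>)) \<longlongrightarrow> 1) (tails E le')"
    by (rule quot_left_ai_lift[OF assms(2) F]) blast
  have D: "directed_set D le" and E: "directed_set E le'"
    using e F by (auto simp: bdd_weak_ai_def bdd_left_ai_def)
  obtain K where K: "\<And>\<alpha>. \<alpha> \<in> D \<Longrightarrow> norm (e \<alpha>) \<le> K"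
    using e unfolding bdd_weak_ai_def bdd_above_def by blast
  obtain L where L: "\<And>\<delta>. \<delta> \<in> E \<Longrightarrow> norm (f \<delta>) \<le> L"
    using f_bdd unfolding bdd_above_def by blast
  let ?T = "tails (D \<times> E) (prod_le le le')"
  define u where "u p = e (fst p) + f (snd p) - e (fst p) * f (snd p)" for p
  have "bdd_weak_ai UNIV (D \<times> E) (prod_le le le') u"
  proof (rule bdd_weak_ai_UNIV_I)
    show "directed_set (D \<times> E) (prod_le le le')" by (rule directed_set_prod[OF D E])
    have "norm (u p) \<le> K + L + K * L" if "p \<in> D \<times> E" for p
    proof -
      have ef: "norm (e (fst p)) \<le> K" "norm (f (snd p)) \<le> L" using that K L by auto
      have "norm (e (fst p) * f (snd p)) \<le> norm (e (fst p)) * norm (f (snd p))"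
        by (rule norm_mult_ineq)
      \<comment> \<open>Monotonicity needs \<open>0 \<le> K\<close>, which follows from
        \<open>K\<close> bounding a norm.\<close>
      also have "\<dots> \<le> K * L" using ef by (intro mult_mono) (auto intro: order_trans[OF norm_ge_zero])
      finally show ?thesis
        unfolding u_def
        using norm_triangle_ineq4[of "e (fst p) + f (snd p)" "e (fst p) * f (snd p)"]
          norm_triangle_ineq[of "e (fst p)" "f (snd p)"] ef by linarith
    qed
    then show "bdd_above ((\<lambda>p. norm (u p)) ` (D \<times> E))" by (intro bdd_aboveI2)
    fix \<psi> :: "'a \<Rightarrow> complex" assume \<psi>: "\<psi> \<in> characters"
    have "((\<lambda>p. (1 - \<psi> (e (fst p))) * (1 - \<psi> (f (snd p)))) \<longlongrightarrow> 0) ?T"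
    proof (cases "\<forall>x\<in>I. \<psi> x = 0")
      case True
      have "((\<lambda>p. 1 - \<psi> (f (snd p))) \<longlongrightarrow> 1 - 1) ?T"
        by (intro tendsto_intros filterlim_compose[OF f_lim[OF \<psi> True]]
            filterlim_snd_tails[OF D E])
      then have lim: "((\<lambda>p. 1 - \<psi> (f (snd p))) \<longlongrightarrow> 0) ?T" by simp
      \<comment> \<open>Here \<open>e (fst p)\<close> lies in \<open>I\<close>, so the first factor
        is exactly 1.\<close>
      have "\<forall>\<^sub>F p in ?T. 1 - \<psi> (f (snd p)) = (1 - \<psi> (e (fst p))) * (1 - \<psi> (f (snd p)))"
        using eventually_tails_mem[OF directed_set_prod[OF D E]]
      proof eventually_elim
        case (elim p)
        then have "e (fst p) \<in> I" using e by (auto simp: bdd_weak_ai_def)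
        then show ?case using True by simp
      qed
      from Lim_transform_eventually[OF lim this] show ?thesis .
    next
      case False
      then obtain a where a: "a \<in> I" "\<psi> a \<noteq> 0" by blast
      \<comment> \<open>The constant \<open>1 + L\<close> bounds the second factor, because
        \<open>\<psi>\<close> is contractive and \<open>L\<close> bounds the norms of
        \<open>f\<close>.\<close>
      have "((\<lambda>p. cmod (1 - \<psi> (e (fst p))) * (1 + L)) \<longlongrightarrow> cmod (1 - 1) * (1 + L)) ?T"
        by (intro tendsto_intros filterlim_compose[OF bdd_weak_ai_tendsto_one[OF e \<psi> a]]
            filterlim_fst_tails[OF D E])
      then have lim: "((\<lambda>p. cmod (1 - \<psi> (e (fst p))) * (1 + L)) \<longlongrightarrow> 0) ?T" by simp
      show ?thesis
      proof (rule Lim_null_comparison[OF _ lim])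
        show "\<forall>\<^sub>F p in ?T. cmod ((1 - \<psi> (e (fst p))) * (1 - \<psi> (f (snd p))))
            \<le> cmod (1 - \<psi> (e (fst p))) * (1 + L)"
          using eventually_tails_mem[OF directed_set_prod[OF D E]]
        proof eventually_elim
          case (elim p)
          then have "norm (f (snd p)) \<le> L" using L by auto
          then have "cmod (1 - \<psi> (f (snd p))) \<le> 1 + L"
            using norm_triangle_ineq4[of 1 "\<psi> (f (snd p))"] norm_character_le[OF \<psi>, of "f (snd p)"]
            by simp
          then show ?case by (simp add: norm_mult mult_left_mono)
        qed
      qed
    qed
    then have "((\<lambda>p. 1 - (1 - \<psi> (e (fst p))) * (1 - \<psi> (f (snd p)))) \<longlongrightarrow> 1 - 0) ?T"
      by (intro tendsto_intros)
    then show "((\<lambda>p. \<psi> (u p)) \<longlongrightarrow> 1) ?T"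
      by (simp add: u_def charactersD[OF \<psi>] algebra_simps)
  qed
  \<comment> \<open>The product net is indexed by pairs in
    \<open>'a set \<times> 'a set set\<close>; this rule reindexes it over
    \<open>'a set\<close>.\<close>
  then show ?thesis by (rule has_bdd_weak_aiI)
qed

end
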